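(* Let $s$ and $t$ be any two odd positive integers. If $\lambda$ is a $\bar{t}$-core bar-partition, then the $\bar{s}$-core $\bar{\gamma}_s(\lambda)$ of $\lambda$ is again a $\bar{t}$-core.
   Context: A bar-partition is a partition with distinct (positive) parts. For an odd positive integer $\ell$, removing an $\ell$-bar from a bar-partition $\lambda$ means one of the following operations: (1) replacing a part $x>\ell$ by $x-\ell$, provided $x-\ell$ is not already a part of $\lambda$; (2) deleting a part equal to $\ell$; (3) deleting two parts $x,y$ with $x+y=\ell$. The $\bar{\ell}$-core $\bar{\gamma}_\ell(\lambda)$ is the bar-partition obtained by successively removing $\ell$-bars until none can be removed; it is independent of the order of removals. A bar-partition is a $\bar{\ell}$-core if no $\ell$-bar can be removed from it (equivalently, it has no bars of length divisible by $\ell$). *)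

theory Defs
  imports "HOL-Library.Confluence"
begin

text \<open>
  The parts of a bar-partition are distinct, so a bar-partition is identified with its finite
  set of positive parts.
\<close>

definition bar_partition :: "nat set \<Rightarrow> bool" where
  "bar_partition \<rho> \<longleftrightarrow> finite \<rho> \<and> 0 \<notin> \<rho>"

text \<open>\<open>remove_bar l \<rho> \<mu>\<close>: \<open>\<mu>\<close> arises from \<open>\<rho>\<close> by removing one \<open>l\<close>-bar.\<close>

inductive remove_bar :: "nat \<Rightarrow> nat set \<Rightarrow> nat set \<Rightarrow> bool" for l :: nat where
  reduce: "x \<in> \<rho> \<Longrightarrow> l < x \<Longrightarrow> x - l \<notin> \<rho> \<Longrightarrow> remove_bar l \<rho> (insert (x - l) (\<rho> - {x}))"
| delete: "l \<in> \<rho> \<Longrightarrow> remove_bar l \<rho> (\<rho> - {l})"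
| delete_pair: "x \<in> \<rho> \<Longrightarrow> y \<in> \<rho> \<Longrightarrow> x \<noteq> y \<Longrightarrow> x + y = l \<Longrightarrow> remove_bar l \<rho> (\<rho> - {x, y})"

definition is_bar_core :: "nat \<Rightarrow> nat set \<Rightarrow> bool" where
  "is_bar_core l \<rho> \<longleftrightarrow> bar_partition \<rho> \<and> (\<nexists>\<mu>. remove_bar l \<rho> \<mu>)"

definition bar_core :: "nat \<Rightarrow> nat set \<Rightarrow> nat set" where
  "bar_core l \<rho> = (THE \<mu>. (remove_bar l)\<^sup>*\<^sup>* \<rho> \<mu> \<and> is_bar_core l \<mu>)"

text \<open>
  The definite description above is meaningful: for positive \<open>l\<close> the removal process terminates,
  and its result does not depend on the order of the removals.
\<close>

lemma bar_partition_remove_bar: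
  assumes "remove_bar l \<rho> \<mu>" "bar_partition \<rho>"
  shows "bar_partition \<mu>"
  using assms by cases (auto simp: bar_partition_def)

lemma bar_partition_remove_bars:
  assumes "(remove_bar l)\<^sup>*\<^sup>* \<rho> \<mu>" "bar_partition \<rho>"
  shows "bar_partition \<mu>"
  using assms by induction (auto intro: bar_partition_remove_bar)

lemma sum_remove_bar_less:
  assumes "remove_bar l \<rho> \<mu>" "bar_partition \<rho>" "0 < l"
  shows "\<Sum>\<mu> < \<Sum>\<rho>"
  using assms(1)
proof cases
  case (reduce x)
  have fin: "finite \<rho>" using assms(2) by (simp add: bar_partition_def)
  have "\<Sum>\<rho> = x + \<Sum>(\<rho> - {x})" using fin reduce by (simp add: sum.remove)
  moreover have "\<Sum>\<mu> = (x - l) + \<Sum>(\<rho> - {x})" using fin reduce by simp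
  ultimately show ?thesis using assms(3) reduce by linarith
next
  case delete
  then show ?thesis using assms by (simp add: bar_partition_def sum.remove)
next
  case (delete_pair x y)
  have fin: "finite \<rho>" using assms(2) by (simp add: bar_partition_def)
  have "\<Sum>\<rho> = x + \<Sum>(\<rho> - {x})" using fin delete_pair by (simp add: sum.remove)
  also have "\<Sum>(\<rho> - {x}) = y + \<Sum>(\<rho> - {x} - {y})"
    using fin delete_pair by (intro sum.remove) auto
  also have "\<rho> - {x} - {y} = \<mu>" using delete_pair by auto
  finally show ?thesis using assms(3) delete_pair by linarith
qed

lemma bar_core_exists:
  assumes "bar_partition \<rho>" "0 < l"
  shows "\<exists>\<mu>. (remove_bar l)\<^sup>*\<^sup>* \<rho> \<mu> \<and> is_bar_core l \<mu>"
  using assms(1)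
proof (induction "\<Sum>\<rho>" arbitrary: \<rho> rule: less_induct)
  case less
  show ?case
  proof (cases "\<exists>\<mu>. remove_bar l \<rho> \<mu>")
    case True
    then obtain \<mu> where \<mu>: "remove_bar l \<rho> \<mu>" by blast
    then show ?thesis
      using less assms(2) sum_remove_bar_less bar_partition_remove_bar
      by (meson converse_rtranclp_into_rtranclp)
  next
    case False
    then show ?thesis using less.prems by (auto simp: is_bar_core_def)
  qed
qed

lemma remove_bar_diamond:
  assumes "remove_bar l \<rho> \<mu>" "remove_bar l \<rho> \<nu>" "bar_partition \<rho>" "\<mu> \<noteq> \<nu>"
  shows "\<exists>\<kappa>. remove_bar l \<mu> \<kappa> \<and> remove_bar l \<nu> \<kappa>"
proof -
  have pos: "0 \<notin> \<rho>" using assms(3) by (simp add: bar_partition_def)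
  note rb = remove_bar.intros
  have rd: "\<exists>\<kappa>. remove_bar l (insert (x - l) (\<rho> - {x})) \<kappa> \<and> remove_bar l (\<rho> - {l}) \<kappa>"
    if "x \<in> \<rho>" "l < x" "x - l \<notin> \<rho>" "l \<in> \<rho>" for x
  proof (intro exI conjI)
    show "remove_bar l (insert (x - l) (\<rho> - {x})) (insert (x - l) (\<rho> - {x}) - {l})"
      using that by (intro rb(2)) auto
    have "insert (x - l) (\<rho> - {x}) - {l} = insert (x - l) (\<rho> - {l} - {x})" using that by auto
    then show "remove_bar l (\<rho> - {l}) (insert (x - l) (\<rho> - {x}) - {l})"
      using that rb(1)[of x "\<rho> - {l}" l] by auto
  qed
  have rp: "\<exists>\<kappa>. remove_bar l (insert (x - l) (\<rho> - {x})) \<kappa> \<and> remove_bar l (\<rho> - {a, b}) \<kappa>"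
    if "x \<in> \<rho>" "l < x" "x - l \<notin> \<rho>" "a \<in> \<rho>" "b \<in> \<rho>" "a \<noteq> b" "a + b = l" for x a b
  proof (intro exI conjI)
    show "remove_bar l (insert (x - l) (\<rho> - {x})) (insert (x - l) (\<rho> - {x}) - {a, b})"
      using that by (intro rb(3)) auto
    have "insert (x - l) (\<rho> - {x}) - {a, b} = insert (x - l) (\<rho> - {a, b} - {x})"
      using that by auto
    then show "remove_bar l (\<rho> - {a, b}) (insert (x - l) (\<rho> - {x}) - {a, b})"
      using that rb(1)[of x "\<rho> - {a, b}" l] by auto
  qed
  have dp: "\<exists>\<kappa>. remove_bar l (\<rho> - {l}) \<kappa> \<and> remove_bar l (\<rho> - {a, b}) \<kappa>"
    if "l \<in> \<rho>" "a \<in> \<rho>" "b \<in> \<rho>" "a \<noteq> b" "a + b = l" for a b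
  proof (intro exI conjI)
    have ne: "a \<noteq> l" "b \<noteq> l" "a \<noteq> 0" "b \<noteq> 0" using that pos by (metis add_0_right add_left_cancel add_0_left add_right_cancel)+
    show "remove_bar l (\<rho> - {l}) (\<rho> - {l} - {a, b})"
      using that ne by (intro rb(3)) auto
    have "\<rho> - {l} - {a, b} = \<rho> - {a, b} - {l}" by auto
    then show "remove_bar l (\<rho> - {a, b}) (\<rho> - {l} - {a, b})"
      using that ne rb(2)[of l "\<rho> - {a, b}"] by auto
  qed
  show ?thesis
    using assms(1)
  proof cases
    case 1: (reduce x)
    from assms(2) show ?thesis
    proof cases
      case 2: (reduce y)
      have "x \<noteq> y" using 1 2 assms(4) by auto
      then have ne: "x - l \<noteq> y - l" "x - l \<noteq> y" "y - l \<noteq> x" using 1 2 by auto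
      have "remove_bar l \<mu> (insert (y - l) (\<mu> - {y}))"
        using 1 2 ne \<open>x \<noteq> y\<close> by (intro rb(1)) auto
      moreover have "remove_bar l \<nu> (insert (x - l) (\<nu> - {x}))"
        using 1 2 ne \<open>x \<noteq> y\<close> by (intro rb(1)) auto
      moreover have "insert (y - l) (\<mu> - {y}) = insert (x - l) (\<nu> - {x})"
        using 1 2 ne \<open>x \<noteq> y\<close> by auto
      ultimately show ?thesis by auto
    qed (use 1 rd rp in auto)
  next
    case 1: delete
    from assms(2) show ?thesis
      by cases (use 1 rd dp assms(4) in blast)+
  next
    case 1: (delete_pair a b)
    from assms(2) show ?thesis
    proof cases
      case 2: (delete_pair c d)
      have ne: "a \<notin> {c, d}" "b \<notin> {c, d}" using 1 2 assms(4) by auto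
      have "remove_bar l \<mu> (\<mu> - {c, d})" using 1 2 ne by (intro rb(3)) auto
      moreover have "remove_bar l \<nu> (\<nu> - {a, b})" using 1 2 ne by (intro rb(3)) auto
      moreover have "\<mu> - {c, d} = \<nu> - {a, b}" using 1 2 by auto
      ultimately show ?thesis by auto
    qed (use 1 rp dp in blast)+
  qed
qed

lemma bar_core_unique:
  assumes "bar_partition \<rho>"
    and "(remove_bar l)\<^sup>*\<^sup>* \<rho> \<mu>" "is_bar_core l \<mu>"
    and "(remove_bar l)\<^sup>*\<^sup>* \<rho> \<nu>" "is_bar_core l \<nu>"
  shows "\<mu> = \<nu>"
proof -
  let ?r = "\<lambda>\<alpha> \<beta>. bar_partition \<alpha> \<and> remove_bar l \<alpha> \<beta>"
  have "strong_confluentp ?r"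
  proof
    fix x y z assume *: "?r x y" "?r x z"
    show "\<exists>u. ?r\<^sup>*\<^sup>* y u \<and> ?r\<^sup>=\<^sup>= z u"
    proof (cases "y = z")
      case False
      then obtain u where "remove_bar l y u" "remove_bar l z u"
        using remove_bar_diamond * by blast
      moreover have "bar_partition y" "bar_partition z"
        using * bar_partition_remove_bar by blast+
      ultimately show ?thesis by (intro exI[of _ u]) auto
    qed auto
  qed
  then have conf: "confluentp ?r" by (rule strong_confluentp_imp_confluentp)
  have restrict: "?r\<^sup>*\<^sup>* \<rho> \<kappa>" if "(remove_bar l)\<^sup>*\<^sup>* \<rho> \<kappa>" for \<kappa>
    using that
  proof induction
    case (step y z)
    then have "?r y z" using bar_partition_remove_bars assms(1) by blast
    then show ?case using step.IH by (rule rtranclp.rtrancl_into_rtrancl[rotated])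
  qed simp
  obtain u where u: "?r\<^sup>*\<^sup>* \<mu> u" "?r\<^sup>*\<^sup>* \<nu> u"
    using confluentpD[OF conf] restrict assms(2,4) by blast
  have stuck: "\<kappa> = u" if "?r\<^sup>*\<^sup>* \<kappa> u" "is_bar_core l \<kappa>" for \<kappa>
    using that by (auto simp: is_bar_core_def elim: converse_rtranclpE)
  show ?thesis using stuck[OF u(1) assms(3)] stuck[OF u(2) assms(5)] by simp
qed

lemma bar_core:
  assumes "bar_partition \<rho>" "0 < l"
  shows "(remove_bar l)\<^sup>*\<^sup>* \<rho> (bar_core l \<rho>)" and "is_bar_core l (bar_core l \<rho>)"
proof -
  have "\<exists>!\<mu>. (remove_bar l)\<^sup>*\<^sup>* \<rho> \<mu> \<and> is_bar_core l \<mu>"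
    using bar_core_exists[OF assms] bar_core_unique[OF assms(1)] by blast
  then have "(remove_bar l)\<^sup>*\<^sup>* \<rho> (bar_core l \<rho>) \<and> is_bar_core l (bar_core l \<rho>)"
    unfolding bar_core_def by (rule theI')
  then show "(remove_bar l)\<^sup>*\<^sup>* \<rho> (bar_core l \<rho>)" "is_bar_core l (bar_core l \<rho>)" by auto
qed

end

theory Submission
  imports Defs
begin

text \<open>
  Encode a bar-partition \<open>\<rho>\<close> by the beads \<open>x\<close> for \<open>x \<in> \<rho>\<close> and \<open>-x\<close> for positive \<open>x \<notin> \<rho>\<close>, with half
  a bead at \<open>0\<close>. Removing an \<open>l\<close>-bar moves beads down by \<open>l\<close>, so \<open>\<rho>\<close> is an \<open>l\<close>-core iff the occupation
  number never increases from \<open>z - l\<close> to \<open>z\<close>. On a residue class modulo \<open>s\<close>, taking the \<open>s\<close>-core sorts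
  the beads and preserves their (normalised) number. For a \<open>t\<close>-core the class of \<open>a\<close> is dominated
  pointwise by the class of \<open>a - t\<close>, hence also in number; and for sorted classes domination in
  number implies pointwise domination.
\<close>

section \<open>Bead encoding of cores\<close>

text \<open>Occupation numbers are doubled, so that the half bead at \<open>0\<close> has the integer value \<open>1\<close>.\<close>

definition bead :: "nat set \<Rightarrow> int \<Rightarrow> int" where
  "bead \<rho> z = (if z = 0 then 1 else if (0 < z) = (nat \<bar>z\<bar> \<in> \<rho>) then 2 else 0)"

lemma bead_nonneg: "0 \<le> bead \<rho> z"
  and bead_le_2: "bead \<rho> z \<le> 2"
  by (simp_all add: bead_def)

lemma bead_0 [simp]: "bead \<rho> 0 = 1"
  by (simp add: bead_def)

lemma bead_nonzero: "z \<noteq> 0 \<Longrightarrow> bead \<rho> z = 0 \<or> bead \<rho> z = 2"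
  by (simp add: bead_def)

lemma bead_of_nat: "0 < x \<Longrightarrow> bead \<rho> (int x) = (if x \<in> \<rho> then 2 else 0)"
  by (simp add: bead_def)

lemma bead_uminus: "bead \<rho> (- z) = 2 - bead \<rho> z"
  by (auto simp: bead_def)

lemma bead_insert:
  assumes "0 < x" "x \<notin> \<rho>"
  shows "bead (insert x \<rho>) z = bead \<rho> z + 2 * of_bool (z = int x) - 2 * of_bool (z = - int x)"
  using assms by (auto simp: bead_def)

text \<open>For \<open>z > 0\<close> the inequality fails exactly when a bar can be removed at part
  \<open>z\<close>: \<open>reduce\<close> if \<open>z > l\<close>, \<open>delete\<close> if
  \<open>z = l\<close> (a bead meets the half bead at 0), \<open>delete_pair\<close> with
  \<open>l - z\<close> if \<open>z < l\<close>.\<close>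

lemma is_bar_core_iff_bead:
  assumes "odd l"
  shows "is_bar_core l \<rho> \<longleftrightarrow> bar_partition \<rho> \<and> (\<forall>z. bead \<rho> z \<le> bead \<rho> (z - int l))"
proof (intro iffI conjI allI)
  assume core: "is_bar_core l \<rho>"
  then show bp: "bar_partition \<rho>" by (simp add: is_bar_core_def)
  have no: "\<not> remove_bar l \<rho> \<mu>" for \<mu> using core by (simp add: is_bar_core_def)
  have l: "l \<notin> \<rho>" using no remove_bar.delete by blast
  have "0 < l" using assms by (simp add: odd_pos)
  have pos: "bead \<rho> z \<le> bead \<rho> (z - int l)" if "0 < z" for z
  proof (cases "nat z \<in> \<rho>")
    case False
    then show ?thesis using that bead_nonneg[of \<rho> "z - int l"] by (simp add: bead_def)
  next
    case True
    define x where "x = nat z"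
    have z: "z = int x" "0 < x" "x \<in> \<rho>" using that True by (auto simp: x_def)
    have "x \<noteq> l" using z l by auto
    then consider "l < x" | "x < l" by linarith
    then show ?thesis
    proof cases
      case 1
      then have "x - l \<in> \<rho>" using no remove_bar.reduce[of x \<rho> l] z by blast
      then show ?thesis using 1 z bead_of_nat[of "x - l" \<rho>] bead_le_2 by simp
    next
      case 2
      \<comment> \<open>Oddness of \<open>l\<close> makes the two parts distinct, as
        \<open>delete_pair\<close> demands.\<close>
      have "x \<noteq> l - x" using assms 2 by presburger
      then have "l - x \<notin> \<rho>" using no remove_bar.delete_pair[of x \<rho> "l - x" l] z 2 by auto
      then have "bead \<rho> (- int (l - x)) = 2"
        using 2 unfolding bead_uminus by (subst bead_of_nat) auto
      moreover have "z - int l = - int (l - x)" using 2 z by simp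
      ultimately show ?thesis by (simp only: bead_le_2)
    qed
  qed
  fix z
  \<comment> \<open>The inequality is invariant under \<open>z \<mapsto> l - z\<close> by
    \<open>bead_uminus\<close>, which reduces \<open>z \<le> 0\<close> to the positive case.\<close>
  consider "0 < z" | "z \<le> 0" "z - int l < 0"
    using \<open>0 < l\<close> by linarith
  then show "bead \<rho> z \<le> bead \<rho> (z - int l)"
  proof cases
    case 2
    have "bead \<rho> (int l - z) \<le> bead \<rho> (int l - z - int l)" using 2 by (intro pos) auto
    then show ?thesis using bead_uminus[of \<rho> "z - int l"] bead_uminus[of \<rho> z] by simp
  qed (rule pos)
next
  assume *: "bar_partition \<rho> \<and> (\<forall>z. bead \<rho> z \<le> bead \<rho> (z - int l))"
  then have mono: "bead \<rho> z \<le> bead \<rho> (z - int l)" for z by blast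
  have pos: "0 < x" if "x \<in> \<rho>" for x using * that by (auto simp: bar_partition_def intro: gr0I)
  have "\<not> remove_bar l \<rho> \<mu>" for \<mu>
  proof
    assume "remove_bar l \<rho> \<mu>"
    then show False
    proof cases
      case (reduce x)
      then show ?thesis
        using mono[of "int x"] bead_of_nat[of x \<rho>] bead_of_nat[of "x - l" \<rho>] pos[of x]
        by simp
    next
      case delete
      then show ?thesis using mono[of "int l"] bead_of_nat[of l \<rho>] pos[of l] by simp
    next
      case (delete_pair x y)
      then have "int x - int l = - int y" by auto
      then have "bead \<rho> (int x) \<le> bead \<rho> (- int y)" using mono[of "int x"] by metis
      then show ?thesis
        using delete_pair pos bead_of_nat[of x \<rho>] bead_of_nat[of y \<rho>]
          bead_uminus[of \<rho> "int y"] by simp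
    qed
  qed
  then show "is_bar_core l \<rho>" using * by (simp add: is_bar_core_def)
qed

section \<open>Bead numbers on residue classes\<close>

text \<open>Each part \<open>x\<close> trades the bead at \<open>-x\<close> for one at
  \<open>x\<close>, so this is the number of beads in the class of \<open>a\<close> modulo
  \<open>s\<close>, relative to the empty partition.\<close>

definition charge :: "nat \<Rightarrow> int \<Rightarrow> nat set \<Rightarrow> int" where
  "charge s a \<rho> = (\<Sum>x\<in>\<rho>. of_bool (int s dvd a - int x) - of_bool (int s dvd a + int x))"

text \<open>Modulo \<open>s\<close>, the parts \<open>x\<close> and \<open>x - s\<close> agree, a
  part \<open>s\<close> contributes zero, and parts with sum \<open>s\<close> are opposite, so their
  contributions cancel.\<close>

lemma charge_remove_bar:
  assumes "remove_bar s \<rho> \<mu>" "bar_partition \<rho>"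
  shows "charge s a \<mu> = charge s a \<rho>"
proof -
  let ?f = "\<lambda>x. of_bool (int s dvd a - int x) - of_bool (int s dvd a + int x) :: int"
  have fin: "finite \<rho>" using assms(2) by (simp add: bar_partition_def)
  show ?thesis
    using assms(1)
  proof cases
    case (reduce x)
    have "int s dvd a - int (x - s) \<longleftrightarrow> int s dvd (a - int x) + int s"
      "int s dvd a + int (x - s) \<longleftrightarrow> int s dvd (a + int x) - int s"
      using reduce by (auto simp: algebra_simps)
    then have "?f (x - s) = ?f x"
      using dvd_add_left_iff[of "int s" "int s"] dvd_diff_left_iff[of "int s" "int s"] by simp
    then show ?thesis
      using fin reduce by (simp add: charge_def sum.remove[of \<rho> x])
  next
    case delete
    have "?f s = 0"
      using dvd_add_left_iff[of "int s" "int s"] dvd_diff_left_iff[of "int s" "int s"] by simp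
    then show ?thesis
      using fin delete by (simp add: charge_def sum.remove[of \<rho> s])
  next
    case (delete_pair x y)
    have "int s dvd a - int y \<longleftrightarrow> int s dvd (a + int x) - int s"
      "int s dvd a + int y \<longleftrightarrow> int s dvd (a - int x) + int s"
      using delete_pair by (auto simp: algebra_simps)
    then have "?f y = - ?f x"
      using dvd_add_left_iff[of "int s" "int s"] dvd_diff_left_iff[of "int s" "int s"] by simp
    moreover have "\<rho> - {x} - {y} = \<mu>" using delete_pair by auto
    moreover have "sum ?f \<rho> = ?f x + (?f y + sum ?f (\<rho> - {x} - {y}))"
      using fin delete_pair by (simp add: sum.remove[of \<rho> x] sum.remove[of "\<rho> - {x}" y])
    ultimately show ?thesis by (simp add: charge_def)
  qed
qed

lemma charge_remove_bars:
  assumes "(remove_bar s)\<^sup>*\<^sup>* \<rho> \<mu>" "bar_partition \<rho>"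
  shows "charge s a \<mu> = charge s a \<rho>"
  using assms
  by induction (auto simp: charge_remove_bar dest: bar_partition_remove_bars)

lemma sum_of_bool_progression:
  fixes a b s N :: int
  assumes "0 < s" "\<bar>a\<bar> + \<bar>b\<bar> \<le> N"
  shows "(\<Sum>k=-N..N. of_bool (a + s * k = b)) = (of_bool (s dvd a - b) :: int)"
proof (cases "s dvd a - b")
  case True
  then obtain m where m: "a - b = s * m" by blast
  \<comment> \<open>The progression meets \<open>b\<close> only at index \<open>- m\<close>; this
    bound puts it inside the window.\<close>
  have "\<bar>m\<bar> \<le> \<bar>s * m\<bar>" using assms(1) by (simp add: abs_mult mult_le_cancel_right1)
  then have "- m \<in> {-N..N}" using assms(2) m by auto
  moreover have "a + s * k = b \<longleftrightarrow> - m = k" for k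
  proof -
    have "a + s * k = b \<longleftrightarrow> s * (m + k) = 0" using m by (auto simp: algebra_simps)
    then show ?thesis using assms(1) by auto
  qed
  ultimately show ?thesis using True by (simp add: of_bool_def)
next
  case False
  have "a + s * k \<noteq> b" for k
  proof
    assume "a + s * k = b"
    then have "a - b = s * (- k)" by simp
    then show False using False by simp
  qed
  then show ?thesis using False by simp
qed

text \<open>A whole residue class holds infinitely many beads, so they are counted in a window wide
  enough to see every difference from the empty partition.\<close>

lemma sum_bead_eq_charge:
  assumes "finite \<rho>" "0 \<notin> \<rho>" "0 < s" "\<And>x. x \<in> \<rho> \<Longrightarrow> \<bar>a\<bar> + int x \<le> N"
  shows "(\<Sum>k=-N..N. bead \<rho> (a + int s * k))
    = 2 * charge s a \<rho> + (\<Sum>k=-N..N. bead {} (a + int s * k))"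
  using assms
proof (induction \<rho>)
  case empty
  then show ?case by (simp add: charge_def)
next
  case (insert x \<rho>)
  have "0 < x" using insert.prems by (auto intro: gr0I)
  then have "(\<Sum>k=-N..N. bead (insert x \<rho>) (a + int s * k))
    = (\<Sum>k=-N..N. bead \<rho> (a + int s * k))
      + 2 * (\<Sum>k=-N..N. of_bool (a + int s * k = int x))
      - 2 * (\<Sum>k=-N..N. of_bool (a + int s * k = - int x))"
    by (simp only: bead_insert[OF _ insert.hyps(2)] sum.distrib sum_subtractf sum_distrib_left)
  also have "(\<Sum>k=-N..N. of_bool (a + int s * k = int x)) = (of_bool (int s dvd a - int x) :: int)"
    using insert.prems by (intro sum_of_bool_progression) auto
  also have "(\<Sum>k=-N..N. of_bool (a + int s * k = - int x)) = (of_bool (int s dvd a + int x) :: int)"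
    using sum_of_bool_progression[of "int s" a "- int x" N] insert.prems by auto
  finally show ?case
    using insert by (simp add: charge_def)
qed

section \<open>Comparison of sorted classes\<close>

lemma bead_progression_antimono:
  assumes "\<And>z. bead \<rho> z \<le> bead \<rho> (z - int s)" "j \<le> k"
  shows "bead \<rho> (a + int s * k) \<le> bead \<rho> (a + int s * j)"
  using assms(2)
proof (induction k rule: int_ge_induct)
  case (step k)
  then show ?case using assms(1)[of "a + int s * (k + 1)"] by (simp add: algebra_simps)
qed simp

text \<open>If \<open>a\<close> held more than \<open>b\<close>, sortedness would fill the class of
  \<open>a\<close> below index 0 and empty that of \<open>b\<close> above it. Then \<open>a\<close>
  would dominate at every index, strictly at 0, against the sums.\<close>

lemma bead_sorted_le:
  assumes "0 < s" and sorted: "\<And>z. bead \<rho> z \<le> bead \<rho> (z - int s)"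
    and "0 \<le> N" and sum: "(\<Sum>k=-N..N. bead \<rho> (a + int s * k)) \<le> (\<Sum>k=-N..N. bead \<rho> (b + int s * k))"
  shows "bead \<rho> a \<le> bead \<rho> b"
proof (rule ccontr)
  assume gt: "\<not> bead \<rho> a \<le> bead \<rho> b"
  have "bead \<rho> (b + int s * k) \<le> bead \<rho> (a + int s * k)" for k
  proof (cases k "0 :: int" rule: linorder_cases)
    case less
    then have "1 \<le> bead \<rho> (a + int s * k)"
      using bead_progression_antimono[OF sorted, of k 0 a] gt bead_nonneg[of \<rho> b] by simp
    \<comment> \<open>Rules out the half bead, so that occupation at least 1 means 2.\<close>
    moreover have "a + int s * k \<noteq> 0"
    proof
      assume 0: "a + int s * k = 0"
      then have "0 < a" using less assms(1) by (smt (verit) mult_pos_neg of_nat_0_less_iff)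
      then have "bead \<rho> a = 2"
        using gt bead_nonneg[of \<rho> b] bead_nonzero[of a \<rho>] by auto
      then show False using bead_progression_antimono[OF sorted, of k 0 a] less 0 by simp
    qed
    ultimately show ?thesis using bead_nonzero[of "a + int s * k" \<rho>] bead_le_2 by auto
  next
    case greater
    then have "bead \<rho> (b + int s * k) \<le> 1"
      using bead_progression_antimono[OF sorted, of 0 k b] gt bead_le_2[of \<rho> a] by simp
    moreover have "b + int s * k \<noteq> 0"
    proof
      assume 0: "b + int s * k = 0"
      then have "b < 0" using greater assms(1) by (smt (verit) mult_pos_pos of_nat_0_less_iff)
      then have "bead \<rho> b = 0"
        using gt bead_le_2[of \<rho> a] bead_nonzero[of b \<rho>] by auto
      then show False using bead_progression_antimono[OF sorted, of 0 k b] greater 0 by simp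
    qed
    ultimately show ?thesis using bead_nonzero[of "b + int s * k" \<rho>] bead_nonneg by auto
  qed (use gt in simp)
  then have "(\<Sum>k=-N..N. bead \<rho> (b + int s * k)) < (\<Sum>k=-N..N. bead \<rho> (a + int s * k))"
    using gt \<open>0 \<le> N\<close> by (intro sum_strict_mono_ex1) (auto intro!: bexI[of _ 0])
  then show False using sum by simp
qed

theorem theorem2p3:
  fixes s t :: nat and \<rho> :: "nat set"
  assumes "odd s" and "odd t"
    and "bar_partition \<rho>" and "is_bar_core t \<rho>"
  shows "is_bar_core t (bar_core s \<rho>)"
proof -
  define \<mu> where "\<mu> = bar_core s \<rho>"
  have s: "0 < s" using assms(1) by (simp add: odd_pos)
  have steps: "(remove_bar s)\<^sup>*\<^sup>* \<rho> \<mu>" and core: "is_bar_core s \<mu>"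
    using bar_core[OF assms(3) s] by (simp_all add: \<mu>_def)
  have bp: "bar_partition \<mu>" using core by (simp add: is_bar_core_def)
  have sorted: "bead \<mu> z \<le> bead \<mu> (z - int s)" for z
    using core is_bar_core_iff_bead[OF assms(1)] by blast
  have t: "bead \<rho> z \<le> bead \<rho> (z - int t)" for z
    using assms(4) is_bar_core_iff_bead[OF assms(2)] by blast
  have "bead \<mu> a \<le> bead \<mu> (a - int t)" for a
  proof -
    have fin: "finite \<rho>" "finite \<mu>" "0 \<notin> \<rho>" "0 \<notin> \<mu>"
      using assms(3) bp by (auto simp: bar_partition_def)
    \<comment> \<open>One window serves both partitions and both classes.\<close>
    define N where "N = \<bar>a\<bar> + int t + int (\<Sum>(\<rho> \<union> \<mu>))"
    have N: "\<bar>a\<bar> + int x \<le> N" "\<bar>a - int t\<bar> + int x \<le> N" if "x \<in> \<rho> \<union> \<mu>" for x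
    proof -
      have "x \<le> \<Sum>(\<rho> \<union> \<mu>)" using that fin member_le_sum[of x "\<rho> \<union> \<mu>" "\<lambda>x. x"] by simp
      then show "\<bar>a\<bar> + int x \<le> N" "\<bar>a - int t\<bar> + int x \<le> N"
        unfolding N_def by linarith+
    qed
    have sums_eq: "(\<Sum>k=-N..N. bead \<mu> (c + int s * k)) = (\<Sum>k=-N..N. bead \<rho> (c + int s * k))"
      if "c \<in> {a, a - int t}" for c
      using that N fin s charge_remove_bars[OF steps assms(3)]
        sum_bead_eq_charge[of \<rho> s c N] sum_bead_eq_charge[of \<mu> s c N] by auto
    have "bead \<rho> (a + int s * k) \<le> bead \<rho> (a - int t + int s * k)" for k
      using t[of "a + int s * k"] by (simp add: algebra_simps)
    then have "(\<Sum>k=-N..N. bead \<rho> (a + int s * k)) \<le> (\<Sum>k=-N..N. bead \<rho> (a - int t + int s * k))"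
      by (rule sum_mono)
    then have "(\<Sum>k=-N..N. bead \<mu> (a + int s * k)) \<le> (\<Sum>k=-N..N. bead \<mu> (a - int t + int s * k))"
      using sums_eq[of a] sums_eq[of "a - int t"] by simp
    moreover have "0 \<le> N" by (simp add: N_def sum_nonneg)
    ultimately show ?thesis using bead_sorted_le[OF s sorted] by blast
  qed
  then show ?thesis using bp is_bar_core_iff_bead[OF assms(2)] by (simp add: \<mu>_def)
qed

end
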